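(* There exists a set $A\subset\mathbb{N}$ such that $A$ is a basis of order $2$ (every sufficiently large positive integer is a sum of two elements of $A$), and for every partition $A=A_1\sqcup A_2$, at least one of the sumsets $A_1+A_1$ and $A_2+A_2$ does not have bounded gaps.
   Context: For a set $S$ of integers, $S+S=\{s+t: s,t\in S\}$. A set of integers has bounded gaps (is syndetic) if there is a constant $L$ such that every interval of $L$ consecutive positive integers contains an element of the set. *)

theory Defs
  imports Complex_Main "HOL-Library.Set_Algebras"
begin

text \<open>For sets, \<open>S + T\<close> is the elementwise sumset of Set_Algebras; the summands
  need not be distinct.\<close>

definition basis_of_order_2 :: "nat set \<Rightarrow> bool" where
  "basis_of_order_2 A \<longleftrightarrow> (\<exists>N. \<forall>n\<ge>N. n \<in> A + A)"

text \<open>The witness \<open>L = 0\<close> is excluded automatically, the interval then being empty.\<close>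

definition bounded_gaps :: "nat set \<Rightarrow> bool" where
  "bounded_gaps S \<longleftrightarrow> (\<exists>L. \<forall>m>0. \<exists>s\<in>S. s \<in> {m..<m + L})"

end

theory Submission
  imports Defs
begin

text \<open>Let \<open>A\<close> be the union of the blocks \<open>[y, 2y]\<close> and the points \<open>3y + 1\<close>, where \<open>y\<close> runs
  through \<open>0, 2, 12, 62, \<dots>\<close> (each term is followed by \<open>5y + 2\<close>). The sets \<open>0 + [y, 2y]\<close>,
  \<open>[y, 2y] + [y, 2y]\<close> and \<open>(3y + 1) + [y, 2y]\<close> together cover \<open>[y, 5y + 1]\<close>, so \<open>A + A\<close> is
  everything. On the other hand, the elements of \<open>A\<close> below \<open>5y + 2\<close> other than \<open>3y + 1\<close> are at
  most \<open>2y\<close>, so every representation of a number in \<open>[4y + 1, 5y + 1]\<close> uses \<open>3y + 1\<close>. The part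
  of a partition that lacks \<open>3y + 1\<close> therefore has no sums in this interval of length \<open>y + 1\<close>.\<close>

primrec block_start :: "nat \<Rightarrow> nat" where
  "block_start 0 = 0"
| "block_start (Suc k) = 5 * block_start k + 2"

definition block_basis :: "nat set" where
  "block_basis = (\<Union>k. insert (3 * block_start k + 1) {block_start k..2 * block_start k})"

lemma block_start_mono: "j \<le> k \<Longrightarrow> block_start j \<le> block_start k"
  by (rule lift_Suc_mono_le) simp_all

lemma le_block_start: "k \<le> block_start k"
  by (induction k) auto

lemma point_in_block_basis: "3 * block_start k + 1 \<in> block_basis"
  unfolding block_basis_def by blast

lemma block_in_block_basis:
  assumes "block_start k \<le> a" and "a \<le> 2 * block_start k"
  shows "a \<in> block_basis"
  unfolding block_basis_def using assms by auto

text \<open>Earlier blocks, with their points, lie below \<open>block_start k\<close>, because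
  \<open>3 * y + 1 < 5 * y + 2\<close>; later ones start at \<open>5 * block_start k + 2\<close> or
  beyond.\<close>

lemma block_basis_below_next_block:
  assumes "a \<in> block_basis" and "a < 5 * block_start k + 2"
  shows "a \<le> 2 * block_start k \<or> a = 3 * block_start k + 1"
proof -
  obtain j where j: "a = 3 * block_start j + 1 \<or> block_start j \<le> a \<and> a \<le> 2 * block_start j"
    using assms(1) unfolding block_basis_def by auto
  consider "j < k" | "j = k" | "k < j"
    by linarith
  then show ?thesis
  proof cases
    case 1
    then show ?thesis
      using block_start_mono[of "Suc j" k] j by auto
  next
    case 2
    then show ?thesis
      using j by blast
  next
    case 3
    then show ?thesis
      using block_start_mono[of "Suc k" j] j assms(2) by auto
  qed
qed

lemma sumset_block_basis: "n \<in> block_basis + block_basis"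
proof -
  have sum: "n \<in> block_basis + block_basis"
    if "a \<in> block_basis" "n - a \<in> block_basis" "a \<le> n" for a
    using set_plus_intro[OF that(1,2)] that(3) by simp
  have "n < block_start (Suc n)"
    using le_block_start[of "Suc n"] by simp
  then obtain k where k: "block_start k \<le> n" "n < block_start (Suc k)"
    using ex_least_nat_less[of "\<lambda>i. n < block_start i" "Suc n"] by force
  let ?y = "block_start k"
  consider "n \<le> 2 * ?y" | "2 * ?y < n" "n \<le> 3 * ?y" | "3 * ?y < n" "n \<le> 4 * ?y" | "4 * ?y < n"
    by linarith
  then show ?thesis
  proof cases
    case 1
    moreover have "0 \<in> block_basis"
      using block_in_block_basis[of 0 0] by simp
    ultimately show ?thesis
      using k(1) by (intro sum[of 0]) (simp_all add: block_in_block_basis[of k])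
  next
    case 2
    then show ?thesis
      by (intro sum[of ?y] block_in_block_basis[of k]) auto
  next
    case 3
    then show ?thesis
      by (intro sum[of "2 * ?y"] block_in_block_basis[of k]) auto
  next
    case 4
    \<comment> \<open>Here \<open>n - (3 * ?y + 1)\<close> lies between \<open>?y\<close> and
      \<open>2 * ?y\<close>; the upper bound is exactly \<open>n < 5 * ?y + 2\<close>, which
      explains the recurrence.\<close>
    then show ?thesis
      using k(2) by (intro sum[OF point_in_block_basis[of k]] block_in_block_basis[of k]) auto
  qed
qed

lemma sumset_without_point:
  assumes "B \<subseteq> block_basis" and "3 * block_start k + 1 \<notin> B"
    and "s \<in> B + B" and "s < 5 * block_start k + 2"
  shows "s \<le> 4 * block_start k"
proof -
  obtain a b where ab: "s = a + b" "a \<in> B" "b \<in> B"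
    using assms(3) by (auto elim: set_plus_elim)
  \<comment> \<open>Summands do not exceed \<open>s\<close>, so they too lie below the next
    block.\<close>
  have "c \<le> 2 * block_start k" if "c \<in> B" "c \<le> s" for c
    using block_basis_below_next_block[of c k] that assms by auto
  from this[OF ab(2)] this[OF ab(3)] show ?thesis
    using ab(1) by simp
qed

text \<open>A missing point leaves a gap of length at least \<open>block_start k + 1\<close>, which
  is unbounded in \<open>k\<close>. Two disjoint parts cannot both contain all late points.\<close>

lemma bounded_gaps_contains_points:
  assumes "B \<subseteq> block_basis" and "bounded_gaps (B + B)"
  obtains L where "\<And>k. L \<le> k \<Longrightarrow> 3 * block_start k + 1 \<in> B"
proof -
  obtain L where L: "\<And>m. m > 0 \<Longrightarrow> \<exists>s\<in>B + B. s \<in> {m..<m + L}"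
    using assms(2) unfolding bounded_gaps_def by blast
  have "3 * block_start k + 1 \<in> B" if "L \<le> k" for k
  proof (rule ccontr)
    assume point: "3 * block_start k + 1 \<notin> B"
    obtain s where s: "s \<in> B + B" "4 * block_start k + 1 \<le> s" "s < 4 * block_start k + 1 + L"
      using L[of "4 * block_start k + 1"] by auto
    \<comment> \<open>As \<open>L \<le> k \<le> block_start k\<close>, the window of length
      \<open>L\<close> ends before the next block.\<close>
    then have "s < 5 * block_start k + 2"
      using le_block_start[of k] that by linarith
    from sumset_without_point[OF assms(1) point s(1) this] show False
      using s(2) by simp
  qed
  then show thesis
    by (rule that)
qed

theorem theorem3p1:
  shows "\<exists>A :: nat set. basis_of_order_2 A \<and>
    (\<forall>A1 A2. A = A1 \<union> A2 \<and> A1 \<inter> A2 = {} \<longrightarrow>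
      \<not> bounded_gaps (A1 + A1) \<or> \<not> bounded_gaps (A2 + A2))"
proof (intro exI[of _ block_basis] conjI allI impI)
  show "basis_of_order_2 block_basis"
    unfolding basis_of_order_2_def using sumset_block_basis by blast
next
  fix A1 A2
  assume partition: "block_basis = A1 \<union> A2 \<and> A1 \<inter> A2 = {}"
  show "\<not> bounded_gaps (A1 + A1) \<or> \<not> bounded_gaps (A2 + A2)"
  proof (rule ccontr)
    assume "\<not> ?thesis"
    then have gaps: "bounded_gaps (A1 + A1)" "bounded_gaps (A2 + A2)"
      by auto
    obtain L1 where L1: "\<And>k. L1 \<le> k \<Longrightarrow> 3 * block_start k + 1 \<in> A1"
      using bounded_gaps_contains_points[OF _ gaps(1)] partition by blast
    obtain L2 where L2: "\<And>k. L2 \<le> k \<Longrightarrow> 3 * block_start k + 1 \<in> A2"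
      using bounded_gaps_contains_points[OF _ gaps(2)] partition by blast
    show False
      using L1[of "max L1 L2"] L2[of "max L1 L2"] partition by auto
  qed
qed

end
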